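(* Let $\nu,\beta\in]0,+\infty[$ and $p\in[1,+\infty[$ with $\nu-p(\nu-\beta)>0$. Suppose that the Bishop type inequality described in the context holds. Then for any $f\in L^q_{\mathrm{unif}}(E;\mathfrak m)$ we have $|f|\,d\mathfrak m\in K_{\nu,\beta}^{\,p}$ if $q>\nu/(\nu-p(\nu-\beta))$ with $\nu\ge\beta$, or if $q\ge1$ with $\nu<\beta$. Here $f\in L^q_{\mathrm{unif}}(E;\mathfrak m)$ means that $f$ is a measurable function on $E$ with $$\sup_{x\in E}\int_{d(x,y)\le1}|f(y)|^q\,\mathfrak m(dy)<+\infty.$$
   Context: Notation: $]a,b[$ denotes an open interval; "increasing" is in the wide (non-strict) sense. $(E,d)$ is a locally compact separable metric space, $\mathfrak m$ is a positive Radon measure on $E$ with full support, $B_r(x)=\{y\in E: d(x,y)<r\}$. Bishop type inequality: for a fixed increasing positive function $V$ on $]0,+\infty[$, the map $r\mapsto V(r)/r^\nu$ is increasing or bounded, and $\sup_{x\in E}\mathfrak m(B_r(x))\le V(r)$ for all $r>0$. Class $K_{\nu,\beta}^{\,p}$: put $G(r)=r^{\beta-\nu}$ for $r\in]0,+\infty[$ if $\nu>\beta$, $G(r)=\log(r^{-1})$ for $r\in]0,1[$ if $\nu=\beta$, $G(0)=+\infty$, and $G(x,y)=G(d(x,y))$. $K_{\nu,\beta}^{\,p}$ is the set of positive Borel measures $\mu$ on $E$ such that: if $\nu\ge\beta$, $\lim_{r\to0}\sup_{x\in E}\int_{d(x,y)<r}G(x,y)^p\mu(dy)=0$; if $\nu<\beta$,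 $\sup_{x\in E}\int_{d(x,y)\le1}\mu(dy)<+\infty$. *)

theory Defs
  imports "HOL-Analysis.Analysis"
begin

text \<open>
  The space E is the universe of a type of class \<^class>\<open>metric_space\<close>, and d is \<^const>\<open>dist\<close>.
\<close>

definition radon_measure :: "'a::topological_space measure \<Rightarrow> bool" where
  "radon_measure M \<longleftrightarrow>
     sets M = sets borel \<and>
     (\<forall>K. compact K \<longrightarrow> emeasure M K < \<infinity>) \<and>
     (\<forall>A\<in>sets borel. emeasure M A = (INF U\<in>{U. open U \<and> A \<subseteq> U}. emeasure M U)) \<and>
     (\<forall>U. open U \<longrightarrow> emeasure M U = (SUP K\<in>{K. compact K \<and> K \<subseteq> U}. emeasure M K))"

definition measure_support :: "'a::topological_space measure \<Rightarrow> 'a set" where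
  "measure_support M = {x. \<forall>U. open U \<and> x \<in> U \<longrightarrow> emeasure M U > 0}"

text \<open>The dependence on \<open>V\<close> is explicit; only its values on \<open>{0<..}\<close> matter.\<close>

definition bishop_type_inequality ::
    "'a::metric_space measure \<Rightarrow> real \<Rightarrow> (real \<Rightarrow> real) \<Rightarrow> bool" where
  "bishop_type_inequality m \<nu> V \<longleftrightarrow>
     (\<forall>r>0. V r > 0) \<and> mono_on {0<..} V \<and>
     (mono_on {0<..} (\<lambda>r. V r / r powr \<nu>) \<or> bounded ((\<lambda>r. V r / r powr \<nu>) ` {0<..})) \<and>
     (\<forall>r>0. (SUP x. emeasure m (ball x r)) \<le> ennreal (V r))"

text \<open>
  The library has no real powers on \<^typ>\<open>ennreal\<close>. This one is meant for exponents \<open>p > 0\<close>.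
\<close>

definition ennreal_powr :: "ennreal \<Rightarrow> real \<Rightarrow> ennreal" where
  "ennreal_powr x p = (if x = \<infinity> then \<infinity> else ennreal (enn2real x powr p))"

text \<open>
  The function \<open>G\<close>. It is left \<^const>\<open>undefined\<close> where it has no meaning and is never needed:
  for \<open>\<nu> < \<beta>\<close> it does not enter the Kato class, and for \<open>\<nu> = \<beta>\<close> only radii
  below 1 affect the limit.
\<close>

definition kato_kernel :: "real \<Rightarrow> real \<Rightarrow> real \<Rightarrow> ennreal" where
  "kato_kernel \<nu> \<beta> r =
     (if r = 0 then \<infinity>
      else if \<nu> > \<beta> \<and> 0 < r then ennreal (r powr (\<beta> - \<nu>))
      else if \<nu> = \<beta> \<and> 0 < r \<and> r < 1 then ennreal (ln (inverse r))
      else undefined)"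

definition kato_class :: "real \<Rightarrow> real \<Rightarrow> real \<Rightarrow> 'a::metric_space measure set" where
  "kato_class \<nu> \<beta> p = {\<mu>. sets \<mu> = sets borel \<and>
     (if \<nu> \<ge> \<beta>
      then ((\<lambda>r. SUP x. \<integral>\<^sup>+y\<in>ball x r. ennreal_powr (kato_kernel \<nu> \<beta> (dist x y)) p \<partial>\<mu>)
              \<longlongrightarrow> 0) (at_right 0)
      else (SUP x. emeasure \<mu> (cball x 1)) < \<infinity>)}"

definition L_unif :: "real \<Rightarrow> 'a::metric_space measure \<Rightarrow> ('a \<Rightarrow> real) set" where
  "L_unif q m = {f \<in> borel_measurable m.
     (SUP x. \<integral>\<^sup>+y\<in>cball x 1. ennreal (\<bar>f y\<bar> powr q) \<partial>m) < \<infinity>}"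

end

theory Submission
  imports Defs
begin

text \<open>
  Either case of the Bishop type inequality yields \<open>m (B\<^sub>r(x)) \<le> C r\<^sup>\<nu>\<close> for \<open>r \<le> 1\<close>, with
  \<open>C\<close> independent of \<open>x\<close>. Summing over dyadic shells, this gives, uniformly in \<open>x\<close>,
  \<open>\<integral> d(x,y) powr -s m(dy) = O(r powr (\<nu> - s))\<close> over \<open>B\<^sub>r(x)\<close> for \<open>0 < s < \<nu>\<close>
  (\<open>nn_integral_dist_powr_ball_le\<close>).

  Let \<open>\<nu> \<ge> \<beta>\<close>. Near the diagonal the kernel \<open>G\<^sup>p\<close> is at most a multiple of \<open>d powr -t\<close>, where
  \<open>t = p (\<nu> - \<beta>)\<close> if \<open>\<nu> > \<beta>\<close>, and \<open>t\<close> is as small as desired if \<open>\<nu> = \<beta>\<close>, because a logarithm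
  grows more slowly than any power. The hypothesis on \<open>q\<close> says exactly that \<open>t\<close> can be taken with
  \<open>t q < \<nu> (q - 1)\<close> (\<open>kato_kernel_powr_le\<close>). The usual next step is the Hoelder inequality, but a
  pointwise splitting does the same work (\<open>powr_times_le_split\<close>). Fix \<open>a\<close> strictly between \<open>t / (q - 1)\<close> and \<open>\<nu> - t\<close>.
  Where \<open>\<bar>f\<bar> \<le> d powr -a\<close>, the integrand \<open>d powr -t * \<bar>f\<bar>\<close> is at most \<open>d powr -(t + a)\<close>, whose
  integral over \<open>B\<^sub>r(x)\<close> is small since \<open>t + a < \<nu>\<close>. Elsewhere it is at most
  \<open>\<bar>f\<bar> powr q * d powr (a (q - 1) - t)\<close>, whose integral over \<open>B\<^sub>r(x)\<close> is at most a positive power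
  of \<open>r\<close> times the uniform bound on the integrals of \<open>\<bar>f\<bar> powr q\<close>. Both bounds are uniform in
  \<open>x\<close> and tend to \<open>0\<close> with \<open>r\<close>.

  If \<open>\<nu> < \<beta>\<close>, the class asks only for a uniform bound on unit balls, which follows from
  \<open>\<bar>f\<bar> \<le> 1 + \<bar>f\<bar> powr q\<close> and the uniform bound on volumes of balls of radius \<open>2\<close>.
\<close>

section \<open>Volume growth and integrals of negative powers of the distance\<close>

lemma bishop_type_inequality_imp_power_bound:
  assumes "bishop_type_inequality m \<nu> V"
  obtains C where "C > 0"
    and "\<And>x r. 0 < r \<Longrightarrow> r \<le> 1 \<Longrightarrow> emeasure m (ball x r) \<le> ennreal (C * r powr \<nu>)"
proof -
  have pos: "V r > 0" if "r > 0" for r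
    using assms that by (auto simp: bishop_type_inequality_def)
  have "\<exists>C. \<forall>r. 0 < r \<longrightarrow> r \<le> 1 \<longrightarrow> V r / r powr \<nu> \<le> C"
  proof -
    consider "mono_on {0<..} (\<lambda>r. V r / r powr \<nu>)" | "bounded ((\<lambda>r. V r / r powr \<nu>) ` {0<..})"
      using assms by (auto simp: bishop_type_inequality_def)
    then show ?thesis
    proof cases
      case 1
      then have "V r / r powr \<nu> \<le> V 1 / 1 powr \<nu>" if "0 < r" "r \<le> 1" for r
        using mono_onD[OF 1, of r 1] that by simp
      then show ?thesis by blast
    next
      case 2
      then obtain B where "\<forall>y\<in>(\<lambda>r. V r / r powr \<nu>) ` {0<..}. \<bar>y\<bar> \<le> B"
        unfolding bounded_iff real_norm_def by blast
      then have "V r / r powr \<nu> \<le> B" if "0 < r" for r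
        using that by (force intro: order_trans[OF abs_ge_self])
      then show ?thesis by blast
    qed
  qed
  then obtain C where C: "\<And>r. 0 < r \<Longrightarrow> r \<le> 1 \<Longrightarrow> V r / r powr \<nu> \<le> C" by blast
  show thesis
  proof
    show "C > 0" using C[of 1] pos[of 1] by simp
    fix x and r :: real assume r: "0 < r" "r \<le> 1"
    have "emeasure m (ball x r) \<le> (SUP x. emeasure m (ball x r))"
      by (rule SUP_upper) simp
    also have "\<dots> \<le> ennreal (V r)"
      using assms r by (simp add: bishop_type_inequality_def)
    also have "\<dots> \<le> ennreal (C * r powr \<nu>)"
      using C[OF r] r by (intro ennreal_leI) (simp add: field_simps)
    finally show "emeasure m (ball x r) \<le> ennreal (C * r powr \<nu>)" .
  qed
qed

lemma dyadic_scale: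
  fixes d r :: real
  assumes "0 < d" "d < r"
  obtains k where "r * (1/2) ^ Suc k \<le> d" "d < r * (1/2) ^ k"
proof -
  have "\<exists>n. (1/2) ^ n < d / r"
    using assms by (intro real_arch_pow_inv) auto
  then obtain n where "(1/2) ^ n < d / r" by blast
  then have "r * (1/2) ^ n \<le> d" using assms by (simp add: field_simps)
  moreover have "\<not> r * (1/2) ^ 0 \<le> d" using assms by simp
  ultimately obtain k where "\<forall>i\<le>k. \<not> r * (1/2) ^ i \<le> d" "r * (1/2) ^ Suc k \<le> d"
    using ex_least_nat_less[of "\<lambda>n. r * (1/2) ^ n \<le> d" n] by auto
  then show thesis by (intro that[of k]) auto
qed

text \<open>
  On the shell \<open>r 2\<^sup>-\<^sup>k\<^sup>-\<^sup>1 \<le> d(x,y) < r 2\<^sup>-\<^sup>k\<close> the integrand is at most its value at the inner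
  radius, and the shell has volume at most \<open>C (r 2\<^sup>-\<^sup>k) powr \<nu>\<close>. The shells therefore contribute
  a geometric series of ratio \<open>2 powr (s - \<nu>) < 1\<close>. The centre \<open>y = x\<close> contributes
  nothing, as \<open>0 powr -s = 0\<close>.
\<close>

lemma nn_integral_dist_powr_ball_le:
  fixes m :: "'a::metric_space measure"
  assumes sets: "sets m = sets borel" and "C > 0" and "0 < s" "s < \<nu>"
    and vol: "\<And>r. 0 < r \<Longrightarrow> r \<le> 1 \<Longrightarrow> emeasure m (ball x r) \<le> ennreal (C * r powr \<nu>)"
    and r: "0 < r" "r \<le> 1"
  shows "(\<integral>\<^sup>+y\<in>ball x r. ennreal (dist x y powr - s) \<partial>m)
           \<le> ennreal (C * 2 powr s / (1 - 2 powr (s - \<nu>)) * r powr (\<nu> - s))"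
proof -
  define \<rho> where "\<rho> k = r * (1/2) ^ k" for k :: nat
  have \<rho>: "0 < \<rho> k" "\<rho> k \<le> 1" for k
    using r mult_le_one[of r "(1/2) ^ k"] by (auto simp: \<rho>_def power_le_one)
  define w where "w k = \<rho> (Suc k) powr - s" for k
  have "ball x (\<rho> k) \<in> sets m" for k by (simp add: sets)
  note [measurable] = this
  have shell: "ennreal (dist x y powr - s) * indicator (ball x r) y
        \<le> (\<Sum>k. ennreal (w k) * indicator (ball x (\<rho> k)) y)" for y
  proof (cases "0 < dist x y \<and> dist x y < r")
    case True
    then obtain k where k: "r * (1/2) ^ Suc k \<le> dist x y" "dist x y < r * (1/2) ^ k"
      using dyadic_scale by blast
    define T where "T k = ennreal (w k) * indicator (ball x (\<rho> k)) y" for k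
    have "dist x y powr - s \<le> w k"
      using k \<open>0 < s\<close> \<rho>(1)[of "Suc k"] unfolding w_def \<rho>_def
      by (intro powr_mono2') auto
    then have "ennreal (dist x y powr - s) * indicator (ball x r) y \<le> T k"
      using True k by (simp add: T_def \<rho>_def ennreal_leI)
    also have "T k \<le> (\<Sum>k. T k)"
      using sum_le_suminf[of T "{k}"] by simp
    also have "\<dots> = (\<Sum>k. ennreal (w k) * indicator (ball x (\<rho> k)) y)"
      by (simp only: T_def)
    finally show ?thesis .
  next
    case False
    then show ?thesis by (auto simp: indicator_def)
  qed
  define A where "A = C * 2 powr s * r powr (\<nu> - s)"
  have "A \<ge> 0" using \<open>C > 0\<close> by (simp add: A_def)
  define \<theta> where "\<theta> = (2::real) powr (s - \<nu>)"
  have \<theta>: "0 < \<theta>" "\<theta> < 1"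
    using \<open>s < \<nu>\<close> by (auto simp: \<theta>_def powr_less_one)
  have term_eq: "w k * (C * \<rho> k powr \<nu>) = A * \<theta> ^ k" for k
  proof -
    have half: "((1/2::real) ^ j) powr u = 2 powr (- (real j * u))" for j u
      by (simp add: powr_realpow[symmetric] powr_powr powr_minus powr_divide power_one_over
          inverse_eq_divide)
    have "w k * (C * \<rho> k powr \<nu>)
        = C * (r powr - s * r powr \<nu>) * (2 powr (real (Suc k) * s) * 2 powr (- (real k * \<nu>)))"
      using r unfolding w_def \<rho>_def
      by (simp add: powr_mult half del: power_Suc of_nat_Suc)
    also have "\<dots> = C * r powr (\<nu> - s) * 2 powr (real (Suc k) * s - real k * \<nu>)"
      by (simp add: powr_add[symmetric] del: of_nat_Suc)
    also have "real (Suc k) * s - real k * \<nu> = s + real k * (s - \<nu>)"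
      by (simp add: algebra_simps)
    also have "C * r powr (\<nu> - s) * 2 powr (s + real k * (s - \<nu>)) = A * \<theta> ^ k"
      by (simp add: A_def \<theta>_def powr_add powr_realpow[symmetric] powr_powr mult.commute)
    finally show ?thesis .
  qed
  have "(\<integral>\<^sup>+y\<in>ball x r. ennreal (dist x y powr - s) \<partial>m)
      \<le> (\<integral>\<^sup>+y. (\<Sum>k. ennreal (w k) * indicator (ball x (\<rho> k)) y) \<partial>m)"
    by (intro nn_integral_mono shell)
  also have "\<dots> = (\<Sum>k. \<integral>\<^sup>+y. ennreal (w k) * indicator (ball x (\<rho> k)) y \<partial>m)"
    by (intro nn_integral_suminf) measurable
  also have "\<dots> = (\<Sum>k. ennreal (w k) * emeasure m (ball x (\<rho> k)))"
    by (simp add: nn_integral_cmult_indicator)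
  also have "\<dots> \<le> (\<Sum>k. ennreal (A * \<theta> ^ k))"
  proof (intro suminf_le allI)
    fix k
    have "ennreal (w k) * emeasure m (ball x (\<rho> k)) \<le> ennreal (w k) * ennreal (C * \<rho> k powr \<nu>)"
      by (intro mult_left_mono vol \<rho>) simp
    also have "\<dots> = ennreal (A * \<theta> ^ k)"
      unfolding term_eq[symmetric] by (simp add: w_def ennreal_mult')
    finally show "ennreal (w k) * emeasure m (ball x (\<rho> k)) \<le> ennreal (A * \<theta> ^ k)" .
  qed auto
  also have "\<dots> = ennreal (A * (1 / (1 - \<theta>)))"
    using \<theta> \<open>A \<ge> 0\<close>
    by (intro suminf_ennreal_eq sums_mult geometric_sums) auto
  finally show ?thesis by (simp add: A_def \<theta>_def mult_ac)
qed

lemma powr_tendsto_0_at_right_0: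
  fixes a :: real
  assumes "a > 0"
  shows "((\<lambda>r. r powr a) \<longlongrightarrow> 0) (at_right 0)"
  by (rule tendsto_zero_powrI[OF _ tendsto_const[of a] _ assms])
    (auto simp: eventually_at_right_field intro: exI[of _ 1])

lemma null_singleton_of_power_bound:
  fixes m :: "'a::metric_space measure"
  assumes sets: "sets m = sets borel" and "\<nu> > 0"
    and vol: "\<And>r. 0 < r \<Longrightarrow> r \<le> 1 \<Longrightarrow> emeasure m (ball x r) \<le> ennreal (C * r powr \<nu>)"
  shows "{x} \<in> null_sets m"
proof -
  have "((\<lambda>r. C * r powr \<nu>) \<longlongrightarrow> C * 0) (at_right 0)"
    using \<open>\<nu> > 0\<close> by (intro tendsto_mult tendsto_const powr_tendsto_0_at_right_0)
  then have "((\<lambda>r. ennreal (C * r powr \<nu>)) \<longlongrightarrow> ennreal 0) (at_right 0)"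
    by (intro tendsto_ennrealI) simp
  moreover have "\<forall>\<^sub>F r in at_right 0. emeasure m {x} \<le> ennreal (C * r powr \<nu>)"
    unfolding eventually_at_right_field
  proof (intro exI[of _ 1] conjI allI impI)
    fix r :: real assume "0 < r" "r < 1"
    then have "emeasure m {x} \<le> emeasure m (ball x r)"
      by (intro emeasure_mono) (auto simp: sets)
    also have "\<dots> \<le> ennreal (C * r powr \<nu>)" using \<open>0 < r\<close> \<open>r < 1\<close> by (intro vol) auto
    finally show "emeasure m {x} \<le> ennreal (C * r powr \<nu>)" .
  qed simp
  ultimately have "emeasure m {x} \<le> ennreal 0"
    by (intro tendsto_lowerbound) auto
  then show ?thesis by (simp add: null_sets_def sets)
qed

section \<open>Bounding the kernel and splitting the integrand\<close>

lemma ln_inverse_powr_le: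
  fixes x p t :: real
  assumes "0 < x" "x < 1" "0 < p" "0 < t"
  shows "ln (inverse x) powr p \<le> (p / t) powr p * x powr - t"
proof -
  have "t / p * ln (inverse x) = ln (x powr (- t / p))"
    using assms by (simp add: ln_powr ln_inverse)
  also have "\<dots> \<le> x powr (- t / p)"
    using assms by (intro order_trans[OF ln_le_minus_one]) auto
  finally have "ln (inverse x) \<le> p / t * x powr (- t / p)"
    using assms by (simp add: field_simps)
  moreover have "0 \<le> ln (inverse x)" using assms by (simp add: ln_inverse)
  ultimately have "ln (inverse x) powr p \<le> (p / t * x powr (- t / p)) powr p"
    using assms by (intro powr_mono2) auto
  also have "\<dots> = (p / t) powr p * x powr - t"
    using assms by (subst powr_mult) (auto simp: powr_powr)
  finally show ?thesis .
qed

text \<open>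
  The condition \<open>t q < \<nu> (q - 1)\<close> says that \<open>d powr -t\<close>, raised to the exponent conjugate to
  \<open>q\<close>, is still integrable on small balls. For \<open>\<nu> > \<beta>\<close> it is the hypothesis on \<open>q\<close>
  rewritten; for \<open>\<nu> = \<beta>\<close>, where that hypothesis is \<open>q > 1\<close>, every small \<open>t\<close> will do.
\<close>

lemma kato_kernel_powr_le:
  assumes "\<nu> > 0" "p \<ge> 1" "\<nu> \<ge> \<beta>" "\<nu> - p * (\<nu> - \<beta>) > 0" "q > \<nu> / (\<nu> - p * (\<nu> - \<beta>))"
  obtains t C where "0 < t" "t * q < \<nu> * (q - 1)" "0 < C"
    and "\<And>d. 0 < d \<Longrightarrow> d < 1 \<Longrightarrow>
           ennreal_powr (kato_kernel \<nu> \<beta> d) p \<le> ennreal (C * d powr - t)"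
proof -
  have q: "\<nu> < q * (\<nu> - p * (\<nu> - \<beta>))" using assms by (simp add: pos_divide_less_eq)
  show thesis
  proof (cases "\<nu> = \<beta>")
    case True
    with q assms have "q > 1" by simp
    define t where "t = \<nu> * (q - 1) / (2 * q)"
    have "0 < t" using assms \<open>q > 1\<close> by (simp add: t_def)
    show thesis
    proof (rule that)
      show "0 < t" by fact
      show "t * q < \<nu> * (q - 1)" using assms \<open>q > 1\<close> by (simp add: t_def)
      show "0 < (p / t) powr p" using assms \<open>0 < t\<close> by simp
      fix d :: real assume d: "0 < d" "d < 1"
      then have "0 \<le> ln (inverse d)" by (simp add: ln_inverse)
      then have "ennreal_powr (kato_kernel \<nu> \<beta> d) p = ennreal (ln (inverse d) powr p)"
        using d True by (simp add: kato_kernel_def ennreal_powr_def)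
      also have "\<dots> \<le> ennreal ((p / t) powr p * d powr - t)"
        using d assms \<open>0 < t\<close> by (intro ennreal_leI ln_inverse_powr_le) auto
      finally show "ennreal_powr (kato_kernel \<nu> \<beta> d) p \<le> ennreal ((p / t) powr p * d powr - t)" .
    qed
  next
    case False
    with assms have "\<nu> > \<beta>" by simp
    show thesis
    proof (rule that)
      show "0 < p * (\<nu> - \<beta>)" using assms \<open>\<nu> > \<beta>\<close> by simp
      show "p * (\<nu> - \<beta>) * q < \<nu> * (q - 1)" using q by (simp add: algebra_simps)
      show "(0::real) < 1" by simp
      fix d :: real assume d: "0 < d" "d < 1"
      have "(d powr (\<beta> - \<nu>)) powr p = d powr - (p * (\<nu> - \<beta>))"
        by (simp add: powr_powr algebra_simps)
      then show "ennreal_powr (kato_kernel \<nu> \<beta> d) p \<le> ennreal (1 * d powr - (p * (\<nu> - \<beta>)))"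
        using d \<open>\<nu> > \<beta>\<close> by (simp add: kato_kernel_def ennreal_powr_def)
    qed
  qed
qed

text \<open>
  This pointwise inequality replaces the Hoelder inequality: the two terms on the right
  bound the left side where \<open>u \<le> d powr -a\<close> and where \<open>u > d powr -a\<close> respectively.
\<close>

lemma powr_times_le_split:
  fixes d u a t q :: real
  assumes "0 < d" "0 \<le> u" "q \<ge> 1"
  shows "d powr - t * u \<le> d powr - (t + a) + d powr (a * (q - 1) - t) * u powr q"
proof (cases "u \<le> d powr - a")
  case True
  then have "d powr - t * u \<le> d powr - t * d powr - a"
    by (intro mult_left_mono) auto
  also have "\<dots> = d powr - (t + a)"
    by (simp add: powr_add[symmetric])
  finally show ?thesis by (simp add: add_increasing2)
next
  case False
  then have "d powr - a < u" by simp
  with assms have "0 < u" by (metis powr_ge_zero le_less_trans)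
  have "1 = d powr (a * (q - 1)) * (d powr - a) powr (q - 1)"
    using assms by (simp add: powr_powr powr_add[symmetric])
  also have "\<dots> \<le> d powr (a * (q - 1)) * u powr (q - 1)"
    using \<open>d powr - a < u\<close> assms by (intro mult_left_mono powr_mono2) auto
  finally have "d powr - t * u * 1 \<le> d powr - t * u * (d powr (a * (q - 1)) * u powr (q - 1))"
    using assms by (intro mult_left_mono) auto
  also have "\<dots> = (d powr (a * (q - 1)) * d powr - t) * (u powr (q - 1) * u powr 1)"
    using \<open>0 < u\<close> by simp
  also have "\<dots> = d powr (a * (q - 1) - t) * u powr q"
    by (simp only: powr_add[symmetric]) simp
  finally show ?thesis by (simp add: add_increasing)
qed

section \<open>Membership in the Kato class\<close>

theorem theorem4p3:
  fixes m :: "'a::metric_space measure"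
    and \<nu> \<beta> p q :: real and V :: "real \<Rightarrow> real" and f :: "'a \<Rightarrow> real"
  assumes "locally_compact_space (euclidean :: 'a topology)"
    and "separable_space (euclidean :: 'a topology)"
    and "radon_measure m"
    and "measure_support m = UNIV"
    and "\<nu> > 0" and "\<beta> > 0" and "p \<ge> 1"
    and "\<nu> - p * (\<nu> - \<beta>) > 0"
    and "bishop_type_inequality m \<nu> V"
    and "f \<in> L_unif q m"
    and "(\<nu> \<ge> \<beta> \<and> q > \<nu> / (\<nu> - p * (\<nu> - \<beta>))) \<or> (\<nu> < \<beta> \<and> q \<ge> 1)"
  shows "density m (\<lambda>x. ennreal \<bar>f x\<bar>) \<in> kato_class \<nu> \<beta> p"
proof -
  have sets: "sets m = sets borel" using assms(3) by (simp add: radon_measure_def)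
  note [measurable_cong] = sets
  have [measurable]: "f \<in> borel_measurable m" using assms(10) by (simp add: L_unif_def)
  have [measurable]: "ball x r \<in> sets m" "cball x r \<in> sets m" for x :: 'a and r
    by (simp_all add: sets)
  have [measurable]: "(\<lambda>y. dist x y) \<in> borel_measurable m" for x :: 'a
    unfolding measurable_cong_sets[OF sets refl]
    by (intro borel_measurable_continuous_onI continuous_intros)
  define S where "S = enn2real (SUP x. \<integral>\<^sup>+y\<in>cball x 1. ennreal (\<bar>f y\<bar> powr q) \<partial>m)"
  have S: "(\<integral>\<^sup>+y\<in>cball x 1. ennreal (\<bar>f y\<bar> powr q) \<partial>m) \<le> ennreal S" for x
  proof -
    have "(SUP x. \<integral>\<^sup>+y\<in>cball x 1. ennreal (\<bar>f y\<bar> powr q) \<partial>m) < \<infinity>"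
      using assms(10) by (simp add: L_unif_def)
    then have S_eq: "ennreal S = (SUP x. \<integral>\<^sup>+y\<in>cball x 1. ennreal (\<bar>f y\<bar> powr q) \<partial>m)"
      by (simp add: S_def)
    show ?thesis unfolding S_eq by (rule SUP_upper) simp
  qed
  have "S \<ge> 0" by (simp add: S_def)
  obtain C where "C > 0"
    and vol: "\<And>x r. 0 < r \<Longrightarrow> r \<le> 1 \<Longrightarrow> emeasure m (ball x r) \<le> ennreal (C * r powr \<nu>)"
    using bishop_type_inequality_imp_power_bound[OF assms(9)] by blast
  let ?\<mu> = "density m (\<lambda>x. ennreal \<bar>f x\<bar>)"
  show ?thesis
  proof (cases "\<nu> \<ge> \<beta>")
    case True
    then have q: "q > \<nu> / (\<nu> - p * (\<nu> - \<beta>))" using assms(11) by simp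
    obtain t c where t: "0 < t" "t * q < \<nu> * (q - 1)" and "0 < c"
      and ker: "\<And>d. 0 < d \<Longrightarrow> d < 1 \<Longrightarrow>
             ennreal_powr (kato_kernel \<nu> \<beta> d) p \<le> ennreal (c * d powr - t)"
      using kato_kernel_powr_le[OF assms(5,7) True assms(8) q] by blast
    have "q > 0" using q assms(5,8) by (meson divide_pos_pos less_trans)
    then have "0 < \<nu> * (q - 1)" using t by (meson less_trans mult_pos_pos)
    then have "q > 1" using \<open>\<nu> > 0\<close> by (simp add: zero_less_mult_iff)
    have "t / (q - 1) < \<nu> - t"
      using t \<open>q > 1\<close> by (simp add: field_simps)
    \<comment> \<open>The lower bound on \<open>a\<close> makes \<open>e > 0\<close>, the upper bound makes \<open>s < \<nu>\<close>.\<close>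
    then obtain a where a: "t / (q - 1) < a" "a < \<nu> - t" using dense by blast
    define s where "s = t + a"
    define e where "e = a * (q - 1) - t"
    have "0 < t / (q - 1)" using t \<open>q > 1\<close> by simp
    then have s: "0 < s" "s < \<nu>" using a t by (auto simp: s_def)
    have e: "0 < e" using a \<open>q > 1\<close> by (simp add: e_def field_simps)
    define A where "A = C * 2 powr s / (1 - 2 powr (s - \<nu>))"
    have "A \<ge> 0" using \<open>C > 0\<close> s powr_less_one[of 2 "s - \<nu>"] by (simp add: A_def)
    define B where "B r = c * (A * r powr (\<nu> - s) + r powr e * S)" for r
    have bound: "(\<integral>\<^sup>+y\<in>ball x r. ennreal_powr (kato_kernel \<nu> \<beta> (dist x y)) p \<partial>?\<mu>) \<le> ennreal (B r)"
      if r: "0 < r" "r < 1" for r x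
    proof -
      \<comment> \<open>The kernel is infinite at \<open>y = x\<close>, whereas \<open>0 powr -t = 0\<close>. The majorant is
        therefore set to infinity there by hand; this is harmless since \<open>{x}\<close> is null.\<close>
      define h where "h y = (if dist x y = 0 then \<infinity> else ennreal (c * dist x y powr - t))
          * indicator (ball x r) y" for y
      have [measurable]: "h \<in> borel_measurable m" unfolding h_def by measurable
      have "(\<integral>\<^sup>+y\<in>ball x r. ennreal_powr (kato_kernel \<nu> \<beta> (dist x y)) p \<partial>?\<mu>)
          \<le> (\<integral>\<^sup>+y. h y \<partial>?\<mu>)"
        using r ker by (intro nn_integral_mono) (auto simp: h_def indicator_def)
      also have "\<dots> = (\<integral>\<^sup>+y. ennreal \<bar>f y\<bar> * h y \<partial>m)"
        by (intro nn_integral_density) measurable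
      also have "\<dots> \<le> (\<integral>\<^sup>+y. ennreal c * (ennreal (dist x y powr - s) * indicator (ball x r) y
            + ennreal (r powr e) * (ennreal (\<bar>f y\<bar> powr q) * indicator (cball x 1) y)) \<partial>m)"
      proof (rule nn_integral_mono_AE)
        have "AE y in m. y \<notin> {x}"
          by (intro AE_not_in null_singleton_of_power_bound[OF sets assms(5) vol]) auto
        then show "AE y in m. ennreal \<bar>f y\<bar> * h y
          \<le> ennreal c * (ennreal (dist x y powr - s) * indicator (ball x r) y
            + ennreal (r powr e) * (ennreal (\<bar>f y\<bar> powr q) * indicator (cball x 1) y))"
        proof eventually_elim
          case (elim y)
          show ?case
          proof (cases "y \<in> ball x r")
            case True
            define d where "d = dist x y"
            have d: "0 < d" "d < r" using elim True by (auto simp: d_def)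
            have "\<bar>f y\<bar> * (c * d powr - t) = c * (d powr - t * \<bar>f y\<bar>)" by simp
            also have "\<dots> \<le> c * (d powr - s + d powr e * \<bar>f y\<bar> powr q)"
              using powr_times_le_split[of d "\<bar>f y\<bar>" q t a] \<open>q > 1\<close> d \<open>0 < c\<close>
              by (simp add: s_def e_def)
            also have "\<dots> \<le> c * (d powr - s + r powr e * \<bar>f y\<bar> powr q)"
              using d e \<open>0 < c\<close>
              by (intro mult_left_mono add_left_mono mult_right_mono powr_mono2) auto
            finally have le: "\<bar>f y\<bar> * (c * d powr - t)
                \<le> c * (d powr - s + r powr e * \<bar>f y\<bar> powr q)" .
            have "ennreal \<bar>f y\<bar> * h y = ennreal (\<bar>f y\<bar> * (c * d powr - t))"
              using True elim \<open>0 < c\<close> by (simp add: h_def d_def ennreal_mult)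
            also have "\<dots> \<le> ennreal (c * (d powr - s + r powr e * \<bar>f y\<bar> powr q))"
              by (intro ennreal_leI le)
            also have "\<dots> = ennreal c * (ennreal (d powr - s)
                + ennreal (r powr e) * ennreal (\<bar>f y\<bar> powr q))"
              using \<open>0 < c\<close> by (simp add: ennreal_mult ennreal_plus)
            finally show ?thesis using True r by (simp add: d_def)
          qed (simp add: h_def)
        qed
      qed
      also have "\<dots> = ennreal c * ((\<integral>\<^sup>+y\<in>ball x r. ennreal (dist x y powr - s) \<partial>m)
            + ennreal (r powr e) * (\<integral>\<^sup>+y\<in>cball x 1. ennreal (\<bar>f y\<bar> powr q) \<partial>m))"
        by (simp add: nn_integral_cmult nn_integral_add)
      also have "\<dots> \<le> ennreal c * (ennreal (A * r powr (\<nu> - s)) + ennreal (r powr e) * ennreal S)"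
        unfolding A_def using r \<open>C > 0\<close> s
        by (intro mult_left_mono add_mono S nn_integral_dist_powr_ball_le sets vol) auto
      also have "\<dots> = ennreal (B r)"
        using \<open>0 < c\<close> \<open>A \<ge> 0\<close> \<open>S \<ge> 0\<close> by (simp add: B_def ennreal_mult ennreal_plus)
      finally show ?thesis .
    qed
    have "((\<lambda>r. B r) \<longlongrightarrow> c * (A * 0 + 0 * S)) (at_right 0)"
      unfolding B_def using s e
      by (intro tendsto_intros powr_tendsto_0_at_right_0) auto
    then have lim: "((\<lambda>r. ennreal (B r)) \<longlongrightarrow> 0) (at_right 0)"
      using tendsto_ennrealI by fastforce
    have "\<forall>\<^sub>F r in at_right 0.
        (SUP x. \<integral>\<^sup>+y\<in>ball x r. ennreal_powr (kato_kernel \<nu> \<beta> (dist x y)) p \<partial>?\<mu>) \<le> ennreal (B r)"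
      unfolding eventually_at_right_field
      by (intro exI[of _ 1] conjI zero_less_one allI impI SUP_least bound)
    then have "((\<lambda>r. SUP x. \<integral>\<^sup>+y\<in>ball x r. ennreal_powr (kato_kernel \<nu> \<beta> (dist x y)) p \<partial>?\<mu>)
        \<longlongrightarrow> 0) (at_right 0)"
      by (rule tendsto_sandwich[OF always_eventually[OF allI[OF zero_le]] _ tendsto_const lim])
    then show ?thesis using True sets by (simp add: kato_class_def)
  next
    case False
    then have "q \<ge> 1" using assms(11) by simp
    have "emeasure ?\<mu> (cball x 1) \<le> ennreal (V 2) + ennreal S" for x
    proof -
      have le: "ennreal u \<le> 1 + ennreal (u powr q)" if "u \<ge> 0" for u
      proof -
        \<comment> \<open>This is the splitting inequality at \<open>d = 1\<close>.\<close>
        have "u \<le> 1 + u powr q" using powr_times_le_split[of 1 u q] that \<open>q \<ge> 1\<close> by simp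
        then show ?thesis using that
          by (metis ennreal_1 ennreal_leI ennreal_plus powr_ge_zero zero_le_one)
      qed
      have "emeasure ?\<mu> (cball x 1) = (\<integral>\<^sup>+y\<in>cball x 1. ennreal \<bar>f y\<bar> \<partial>m)"
        by (intro emeasure_density) measurable
      also have "\<dots> \<le> (\<integral>\<^sup>+y. indicator (cball x 1) y
            + ennreal (\<bar>f y\<bar> powr q) * indicator (cball x 1) y \<partial>m)"
        by (intro nn_integral_mono) (auto simp: indicator_def le)
      also have "\<dots> = emeasure m (cball x 1) + (\<integral>\<^sup>+y\<in>cball x 1. ennreal (\<bar>f y\<bar> powr q) \<partial>m)"
        by (simp add: nn_integral_add)
      also have "\<dots> \<le> ennreal (V 2) + ennreal S"
      proof (intro add_mono S)
        have "emeasure m (cball x 1) \<le> emeasure m (ball x 2)"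
          by (intro emeasure_mono) auto
        also have "\<dots> \<le> (SUP x. emeasure m (ball x 2))" by (rule SUP_upper) simp
        also have "\<dots> \<le> ennreal (V 2)" using assms(9) by (simp add: bishop_type_inequality_def)
        finally show "emeasure m (cball x 1) \<le> ennreal (V 2)" .
      qed
      finally show ?thesis .
    qed
    then have "(SUP x. emeasure ?\<mu> (cball x 1)) \<le> ennreal (V 2) + ennreal S"
      by (intro SUP_least)
    also have "\<dots> < \<infinity>" by simp
    finally show ?thesis using False sets by (simp add: kato_class_def)
  qed
qed

end
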